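(* For every integer $k$ there is an integer $n \geq 0$ such that every irreducible decomposition of the numerical semigroup $S = \{0, n+1, n+2, \ldots\} = \{0\} \cup \{x \in \mathbb{N} : x \geq n+1\}$ has at least $k$ irreducible components; that is, whenever $S = I_1 \cap \cdots \cap I_m$ with each $I_j$ an irreducible numerical semigroup, one has $m \geq k$.
   Context: $\mathbb{N}$ denotes the set of nonnegative integers. A numerical semigroup is a subset $S \subseteq \mathbb{N}$ that contains $0$, is closed under addition, and has finite complement $\mathbb{N}\setminus S$. A numerical semigroup $\Gamma$ is irreducible if it cannot be written as the intersection of two numerical semigroups each properly containing $\Gamma$. An irreducible decomposition of a numerical semigroup $S$ is an expression of $S$ as the intersection of finitely many irreducible numerical semigroups, which are called the irreducible components of the decomposition. Every numerical semigroup has an irreducible decomposition. *)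

theory Defs
  imports Main
begin

definition numerical_semigroup :: "nat set \<Rightarrow> bool" where
  "numerical_semigroup S \<longleftrightarrow>
     0 \<in> S \<and> (\<forall>x\<in>S. \<forall>y\<in>S. x + y \<in> S) \<and> finite (- S)"

definition irreducible_numerical_semigroup :: "nat set \<Rightarrow> bool" where
  "irreducible_numerical_semigroup G \<longleftrightarrow>
     numerical_semigroup G \<and>
     \<not> (\<exists>A B. numerical_semigroup A \<and> numerical_semigroup B \<and>
          G \<subset> A \<and> G \<subset> B \<and> G = A \<inter> B)"

text \<open>
  The components form a nonempty family \<open>I 1, \<dots>, I m\<close>. They need not be distinct;
  values of \<open>I\<close> outside \<open>{1..m}\<close> are irrelevant.
\<close>
definition irreducible_decomposition :: "nat set \<Rightarrow> nat \<Rightarrow> (nat \<Rightarrow> nat set) \<Rightarrow> bool" where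
  "irreducible_decomposition S m I \<longleftrightarrow>
     numerical_semigroup S \<and> m \<ge> 1 \<and>
     (\<forall>j\<in>{1..m}. irreducible_numerical_semigroup (I j)) \<and>
     S = (\<Inter>j\<in>{1..m}. I j)"

lemma numerical_semigroup_ordinary:
  "numerical_semigroup ({0} \<union> {x. x \<ge> n + 1})"
proof -
  have "- ({0} \<union> {x. x \<ge> n + 1}) \<subseteq> {..n}"
    by auto
  then have "finite (- ({0} \<union> {x. x \<ge> n + 1}))"
    by (rule finite_subset) simp
  then show ?thesis
    unfolding numerical_semigroup_def by auto
qed

end

theory Submission
  imports Defs
begin

text \<open>
  Writing the ordinary semigroup \<open>S = {0, n + 1, \<dots>}\<close> as an intersection means that every
  \<open>x\<close> in \<open>{1..n}\<close> is a gap of some component. The number \<open>n\<close> is chosen together with many test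
  points \<open>n - d\<close> such that no single component can have more than two of them as gaps; many
  components are then needed.

  Let \<open>G \<noteq> UNIV\<close> be an irreducible semigroup containing \<open>S\<close> and let \<open>F \<le> n\<close> be its largest gap.
  By the symmetry of irreducible semigroups, a gap \<open>x\<close> above \<open>F / 2\<close> has its mirror image \<open>F - x\<close>
  in \<open>G\<close> (\<open>irreducible_reflect_gap\<close>). For \<open>d < n / 2\<close>, a gap \<open>n - d\<close> therefore yields the element
  \<open>d - e\<close> of \<open>G\<close>, where \<open>e = n - F\<close>. Suppose this happens for three values \<open>u < v < w\<close> of \<open>d\<close>.
  Then \<open>y = v - e\<close> is a positive element of \<open>G\<close> with \<open>y \<le> v\<close>. If both \<open>w\<close> and \<open>n\<close> are divisible by
  every positive number up to \<open>v\<close>, then \<open>n - w\<close> is a multiple of \<open>y\<close> and hence in \<open>G\<close>, so that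
  \<open>F = (w - e) + (n - w)\<close> is in \<open>G\<close>, which is absurd. Iterated factorials give arbitrarily many
  values \<open>d\<close> with the required divisibility.
\<close>

section \<open>Gaps of irreducible numerical semigroups\<close>

lemma numerical_semigroup_mult_closed:
  assumes "numerical_semigroup G" "y \<in> G"
  shows "c * y \<in> G"
  using assms by (induction c) (auto simp: numerical_semigroup_def)

lemma numerical_semigroup_insert:
  assumes "numerical_semigroup G" "h + h \<in> G"
    and "\<And>s. s \<in> G \<Longrightarrow> s \<noteq> 0 \<Longrightarrow> h + s \<in> G"
  shows "numerical_semigroup (insert h G)"
proof -
  have "h + s \<in> insert h G" if "s \<in> G" for s
    using assms(3)[OF that] by (cases "s = 0") auto
  moreover have "finite (- insert h G)"
    using assms(1) unfolding numerical_semigroup_def by (auto intro: finite_subset[of _ "- G"])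
  ultimately show ?thesis
    using assms(1,2) unfolding numerical_semigroup_def by (auto simp: add.commute)
qed

text \<open>
  If the reflection fails, take the largest gap \<open>h\<close> above \<open>F / 2\<close> whose mirror image is again a gap.
  Maximality lets \<open>h\<close> be adjoined to \<open>G\<close>, and the largest gap \<open>F\<close> can always be adjoined; the two
  extensions meet in \<open>G\<close>, against irreducibility.
\<close>
lemma irreducible_reflect_gap:
  assumes irr: "irreducible_numerical_semigroup G"
    and F: "F \<notin> G" and above: "\<And>z. F < z \<Longrightarrow> z \<in> G"
    and x: "x \<notin> G" "F < 2 * x"
  shows "F - x \<in> G"
proof (rule ccontr)
  assume neg: "F - x \<notin> G"
  define B where "B = {z. z \<notin> G \<and> F < 2 * z \<and> F - z \<notin> G}"
  have G: "numerical_semigroup G"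
    using irr by (simp add: irreducible_numerical_semigroup_def)
  then have zero: "0 \<in> G"
    by (simp add: numerical_semigroup_def)
  have "B \<subseteq> {..F}"
    unfolding B_def using above not_less by blast
  then have finB: "finite B"
    using finite_subset by blast
  define h where "h = Max B"
  have "x \<in> B"
    using x neg by (simp add: B_def)
  then have "h \<in> B"
    using finB unfolding h_def by (intro Max_in) auto
  then have h: "h \<notin> G" "F < 2 * h" "F - h \<notin> G"
    by (auto simp: B_def)
  have "h + s \<in> G" if s: "s \<in> G" "s \<noteq> 0" for s
  proof (rule ccontr)
    assume hs: "h + s \<notin> G"
    have "h + s \<notin> B"
    proof
      assume "h + s \<in> B"
      then have "h + s \<le> h"
        unfolding h_def by (rule Max_ge[OF finB])
      with s show False by simp
    qed
    with hs h have "F - (h + s) \<in> G"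
      by (auto simp: B_def)
    with s G have "F - (h + s) + s \<in> G"
      by (auto simp: numerical_semigroup_def)
    moreover have "h + s \<le> F"
      using hs above not_less by blast
    ultimately show False
      using h by simp
  qed
  moreover have "h + h \<in> G"
    using above h by simp
  ultimately have "numerical_semigroup (insert h G)"
    by (intro numerical_semigroup_insert[OF G])
  moreover have "F \<noteq> 0"
    using F zero by metis
  then have "numerical_semigroup (insert F G)"
    using above by (intro numerical_semigroup_insert[OF G]) auto
  moreover have "h \<noteq> F"
    using h zero by auto
  then have "G = insert h G \<inter> insert F G"
    by auto
  ultimately show False
    using irr F h unfolding irreducible_numerical_semigroup_def by blast
qed

section \<open>Iterated factorials\<close>

text \<open>
  The starting value 4 makes each term more than twice its predecessor, which keeps the test
  points \<open>n - d\<close> strictly above \<open>n / 2\<close>; with 3 the first step \<open>3! = 2 * 3\<close> would give equality.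
\<close>
definition fact_tower :: "nat \<Rightarrow> nat" where
  "fact_tower i = (fact ^^ i) 4"

lemma fact_tower_Suc: "fact_tower (Suc i) = fact (fact_tower i)"
  by (simp add: fact_tower_def)

lemma double_less_fact:
  assumes "4 \<le> (a::nat)"
  shows "2 * a < fact a"
  using assms
proof (induction a rule: dec_induct)
  case base
  show ?case by (simp add: fact_numeral)
next
  case (step a)
  have "2 * Suc a \<le> a * Suc a"
    using step.hyps by (intro mult_le_mono1) simp
  also have "\<dots> = Suc a * a"
    by (rule mult.commute)
  also have "\<dots> < Suc a * fact a"
    using step by (intro mult_strict_left_mono) auto
  finally show ?case by simp
qed

lemma fact_tower_ge_4: "4 \<le> fact_tower i"
proof (induction i)
  case 0
  show ?case by (simp add: fact_tower_def)
next
  case (Suc i)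
  then show ?case
    using double_less_fact[of "fact_tower i"] by (simp add: fact_tower_Suc)
qed

lemma fact_tower_double_less: "2 * fact_tower i < fact_tower (Suc i)"
  using double_less_fact[OF fact_tower_ge_4] by (simp add: fact_tower_Suc)

lemma strict_mono_fact_tower: "strict_mono fact_tower"
proof -
  have "fact_tower i < fact_tower (Suc i)" for i
    using fact_tower_double_less[of i] by simp
  then show ?thesis
    by (simp add: strict_mono_Suc_iff)
qed

lemma double_fact_tower_less:
  assumes "i < j"
  shows "2 * fact_tower i < fact_tower j"
proof -
  have "fact_tower (Suc i) \<le> fact_tower j"
    using assms strict_mono_less_eq[OF strict_mono_fact_tower] by simp
  then show ?thesis
    using fact_tower_double_less[of i] by simp
qed

lemma dvd_fact_tower:
  assumes "0 < y" "y \<le> fact_tower i" "i < j"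
  shows "y dvd fact_tower j"
proof -
  from \<open>i < j\<close> obtain l where "j = Suc l" "i \<le> l"
    by (cases j) auto
  moreover have "fact_tower i \<le> fact_tower l"
    using \<open>i \<le> l\<close> strict_mono_less_eq[OF strict_mono_fact_tower] by simp
  ultimately show ?thesis
    using assms dvd_fact[of y "fact_tower l"] by (simp add: fact_tower_Suc)
qed

section \<open>Test points missed by one component\<close>

text \<open>
  With \<open>n = fact_tower N\<close>, the elements \<open>F - (n - d)\<close> of \<open>G\<close> are the mirror images of gaps \<open>n - d\<close>.
  The index \<open>a\<close> makes the mirror image belonging to \<open>b\<close> positive; a multiple of the latter,
  added to the mirror image belonging to \<open>c\<close>, gives \<open>F\<close>.
\<close>
lemma no_three_reflected_test_points:
  assumes G: "numerical_semigroup G" and F: "F \<notin> G" "F \<le> fact_tower N"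
    and idx: "a < b" "b < c" "c < N"
    and a: "fact_tower N - fact_tower a \<le> F"
    and b: "F - (fact_tower N - fact_tower b) \<in> G"
    and c: "F - (fact_tower N - fact_tower c) \<in> G"
  shows False
proof -
  define y where "y = F - (fact_tower N - fact_tower b)"
  note less = strict_mono_less[OF strict_mono_fact_tower]
  have ord: "fact_tower a < fact_tower b" "fact_tower b < fact_tower c"
    "fact_tower c < fact_tower N"
    using idx less by simp_all
  have y: "0 < y" "y \<le> fact_tower b"
    using a F ord unfolding y_def by linarith+
  have "y dvd fact_tower N - fact_tower c"
    using dvd_fact_tower[OF y] idx by (intro dvd_diff_nat) auto
  then obtain q where q: "fact_tower N - fact_tower c = q * y"
    by (metis dvd_def mult.commute)
  have "fact_tower N - fact_tower c \<in> G"
    unfolding q using numerical_semigroup_mult_closed[OF G] b y_def by simp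
  then have "F - (fact_tower N - fact_tower c) + (fact_tower N - fact_tower c) \<in> G"
    using G c by (auto simp: numerical_semigroup_def)
  moreover have "fact_tower N - fact_tower c \<le> F"
    using a ord by linarith
  ultimately show False
    using F by simp
qed

lemma nat_set_three_increasing:
  fixes A :: "nat set"
  assumes "2 < card A"
  obtains a b c where "a \<in> A" "b \<in> A" "c \<in> A" "a < b" "b < c"
proof -
  have fin: "finite A" and ne: "A \<noteq> {}"
    using assms card.infinite by fastforce+
  have "\<not> A \<subseteq> {Min A, Max A}"
  proof
    assume "A \<subseteq> {Min A, Max A}"
    then have "card A \<le> card {Min A, Max A}"
      by (intro card_mono) auto
    also have "\<dots> \<le> 2"
      by (simp add: card_insert_if)
    finally show False using assms by simp
  qed
  then obtain b where b: "b \<in> A" "b \<noteq> Min A" "b \<noteq> Max A"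
    by auto
  moreover have "Min A \<le> b" "b \<le> Max A"
    using fin b by auto
  ultimately show thesis
    using that[of "Min A" b "Max A"] Min_in[OF fin ne] Max_in[OF fin ne] by simp
qed

lemma card_missed_test_points_le_2:
  assumes irr: "irreducible_numerical_semigroup G"
    and above: "\<And>z. fact_tower N < z \<Longrightarrow> z \<in> G"
  shows "card {i. i < N \<and> fact_tower N - fact_tower i \<notin> G} \<le> 2" (is "card ?A \<le> 2")
proof (rule ccontr)
  assume "\<not> card ?A \<le> 2"
  then have "2 < card ?A" by simp
  then obtain a b c where abc: "a \<in> ?A" "b \<in> ?A" "c \<in> ?A" "a < b" "b < c"
    by (rule nat_set_three_increasing)
  have G: "numerical_semigroup G"
    using irr by (simp add: irreducible_numerical_semigroup_def)
  then have fin: "finite (- G)"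
    by (simp add: numerical_semigroup_def)
  define F where "F = Max (- G)"
  have F_ge: "z \<le> F" if "z \<notin> G" for z
    using fin that unfolding F_def by simp
  have "F \<in> - G"
    using abc fin unfolding F_def by (intro Max_in) auto
  then have F: "F \<notin> G" by simp
  then have F_le: "F \<le> fact_tower N"
    using above not_less by blast
  have reflect: "F - (fact_tower N - fact_tower i) \<in> G" if i: "i \<in> ?A" for i
  proof (rule irreducible_reflect_gap[OF irr F])
    show "z \<in> G" if "F < z" for z
      using F_ge[of z] that by linarith
    show "fact_tower N - fact_tower i \<notin> G"
      using i by simp
    have "2 * fact_tower i < fact_tower N"
      using i by (simp add: double_fact_tower_less)
    then show "F < 2 * (fact_tower N - fact_tower i)"
      using F_le by linarith
  qed
  show False
    using no_three_reflected_test_points[OF G F F_le, of a b c] abc F_ge reflect by simp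
qed

section \<open>Counting components\<close>

theorem theorem2p5:
  shows "\<forall>k::int. \<exists>n::nat. \<forall>(m::nat) (I :: nat \<Rightarrow> nat set).
           irreducible_decomposition ({0} \<union> {x::nat. x \<ge> n + 1}) m I \<longrightarrow> int m \<ge> k"
proof
  fix k :: int
  define N where "N = 2 * nat k"
  define n where "n = fact_tower N"
  have "k \<le> int m" if dec: "irreducible_decomposition ({0} \<union> {x. x \<ge> n + 1}) m I" for m I
  proof -
    define A where "A j = {i. i < N \<and> n - fact_tower i \<notin> I j}" for j
    have irr: "irreducible_numerical_semigroup (I j)" if "j \<in> {1..m}" for j
      using dec that by (simp add: irreducible_decomposition_def)
    have eq: "{0} \<union> {x. x \<ge> n + 1} = (\<Inter>j\<in>{1..m}. I j)"
      using dec by (simp add: irreducible_decomposition_def)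
    have card_A: "card (A j) \<le> 2" if j: "j \<in> {1..m}" for j
    proof -
      have "z \<in> I j" if "fact_tower N < z" for z
      proof -
        have "z \<in> {0} \<union> {x. x \<ge> n + 1}"
          using that by (simp add: n_def)
        then show ?thesis
          unfolding eq using j by blast
      qed
      then show ?thesis
        unfolding A_def n_def by (intro card_missed_test_points_le_2[OF irr[OF j]])
    qed
    have "{..<N} \<subseteq> (\<Union>j\<in>{1..m}. A j)"
    proof
      fix i assume "i \<in> {..<N}"
      then have "i < N" by simp
      then have "fact_tower i < n" "0 < fact_tower i"
        using double_fact_tower_less[of i N] fact_tower_ge_4[of i] by (simp_all add: n_def)
      then have "n - fact_tower i \<notin> {0} \<union> {x. x \<ge> n + 1}"
        by auto
      then show "i \<in> (\<Union>j\<in>{1..m}. A j)"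
        unfolding eq using \<open>i < N\<close> by (auto simp: A_def)
    qed
    then have "card {..<N} \<le> card (\<Union>j\<in>{1..m}. A j)"
      by (intro card_mono) (auto simp: A_def)
    also have "\<dots> \<le> (\<Sum>j\<in>{1..m}. card (A j))"
      by (intro card_UN_le) simp
    also have "\<dots> \<le> (\<Sum>j\<in>{1..m}. 2)"
      by (intro sum_mono card_A)
    finally show ?thesis
      by (simp add: N_def)
  qed
  then show "\<exists>n. \<forall>m I. irreducible_decomposition ({0} \<union> {x. x \<ge> n + 1}) m I \<longrightarrow> k \<le> int m"
    by blast
qed

end
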